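(* The Dirichlet problem $$\begin{cases}\bar\partial^2 w=0, & \text{in }\mathbb{D},\\ w=0, & \text{on }\partial\mathbb{D},\end{cases}$$ for bicomplex-valued functions $w$, has infinitely many solutions.
   Context: $\mathbb{D}$ is the open unit disk in $\mathbb{C}$. The bicomplex numbers $\mathbb{B}$ are the commutative algebra of elements $z_1+jz_2$ with $z_1,z_2\in\mathbb{C}$, $j^2=-1$, $ij=ji$. The operator $\bar\partial=\frac12\left(\frac{\partial}{\partial x}+j\frac{\partial}{\partial y}\right)$ acts on $\mathbb{B}$-valued functions of $z=x+iy$. The boundary condition prescribes boundary values in the usual sense of the Dirichlet problem. *)

theory Defs
  imports "HOL-Analysis.Analysis"
begin

section \<open>Bicomplex numbers\<close>

text \<open>\<open>Bicomplex z1 z2\<close> stands for \<open>z1 + j z2\<close>; see \<open>Bicomplex_eq\<close> below.\<close>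

datatype bicomplex = Bicomplex (fst_bc: complex) (snd_bc: complex)

lemma bicomplex_eq_iff: "x = y \<longleftrightarrow> fst_bc x = fst_bc y \<and> snd_bc x = snd_bc y"
  by (rule bicomplex.expand[THEN iffI[rotated]]) auto

instantiation bicomplex :: comm_ring_1
begin

definition "0 = Bicomplex 0 0"
definition "1 = Bicomplex 1 0"
definition "x + y = Bicomplex (fst_bc x + fst_bc y) (snd_bc x + snd_bc y)"
definition "- x = Bicomplex (- fst_bc x) (- snd_bc x)"
definition "x - y = Bicomplex (fst_bc x - fst_bc y) (snd_bc x - snd_bc y)"
definition "x * y =
  Bicomplex (fst_bc x * fst_bc y - snd_bc x * snd_bc y)
            (fst_bc x * snd_bc y + snd_bc x * fst_bc y)"

instance
  by standard
    (simp_all add: bicomplex_eq_iff zero_bicomplex_def one_bicomplex_def plus_bicomplex_def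
       uminus_bicomplex_def minus_bicomplex_def times_bicomplex_def algebra_simps)

end

instantiation bicomplex :: real_algebra_1
begin

definition "r *\<^sub>R x = Bicomplex (r *\<^sub>R fst_bc x) (r *\<^sub>R snd_bc x)"

instance
  by standard
    (simp_all add: bicomplex_eq_iff plus_bicomplex_def scaleR_bicomplex_def times_bicomplex_def
       algebra_simps)

end

text \<open>The norm is the Euclidean norm of \<open>\<complex>\<^sup>2\<close>. It is not submultiplicative, so the
  type is not an instance of \<^class>\<open>real_normed_algebra\<close>.\<close>

instantiation bicomplex :: real_normed_vector
begin

definition "norm x = norm (fst_bc x, snd_bc x)"
definition "sgn (x::bicomplex) = x /\<^sub>R norm x"
definition "dist x y = norm (x - y :: bicomplex)"
definition "(uniformity :: (bicomplex \<times> bicomplex) filter) =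
  (INF e\<in>{0 <..}. principal {(x, y). dist x y < e})"
definition "open (U :: bicomplex set) \<longleftrightarrow>
  (\<forall>x\<in>U. eventually (\<lambda>(x', y). x' = x \<longrightarrow> y \<in> U) uniformity)"

instance
proof
  fix x y :: bicomplex and r :: real
  show "norm (x + y) \<le> norm x + norm y"
    using norm_triangle_ineq[of "(fst_bc x, snd_bc x)" "(fst_bc y, snd_bc y)"]
    by (simp add: norm_bicomplex_def plus_bicomplex_def)
  show "norm (r *\<^sub>R x) = \<bar>r\<bar> * norm x"
    using norm_scaleR[of r "(fst_bc x, snd_bc x)"]
    by (simp add: norm_bicomplex_def scaleR_bicomplex_def)
  show "norm x = 0 \<longleftrightarrow> x = 0"
    by (simp add: norm_bicomplex_def bicomplex_eq_iff zero_bicomplex_def zero_prod_def)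
qed (simp_all add: sgn_bicomplex_def dist_bicomplex_def uniformity_bicomplex_def
       open_bicomplex_def)

end

definition bicomplex_of_complex :: "complex \<Rightarrow> bicomplex"
  where "bicomplex_of_complex z = Bicomplex z 0"

definition bc_j :: bicomplex
  where "bc_j = Bicomplex 0 1"

lemma Bicomplex_eq:
  "Bicomplex z1 z2 = bicomplex_of_complex z1 + bc_j * bicomplex_of_complex z2"
  by (simp add: bicomplex_of_complex_def bc_j_def plus_bicomplex_def times_bicomplex_def)

lemma bc_j_squared: "bc_j * bc_j = - 1"
  by (simp add: bc_j_def times_bicomplex_def uminus_bicomplex_def one_bicomplex_def)


section \<open>Partial derivatives and the operator \<open>dbar\<close>\<close>

definition partial_x :: "(complex \<Rightarrow> 'a::real_normed_vector) \<Rightarrow> complex \<Rightarrow> 'a"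
  where "partial_x f z = vector_derivative (\<lambda>t::real. f (z + of_real t)) (at 0)"

definition partial_y :: "(complex \<Rightarrow> 'a::real_normed_vector) \<Rightarrow> complex \<Rightarrow> 'a"
  where "partial_y f z = vector_derivative (\<lambda>t::real. f (z + \<i> * of_real t)) (at 0)"

definition dbar :: "(complex \<Rightarrow> bicomplex) \<Rightarrow> complex \<Rightarrow> bicomplex"
  where "dbar w z = (1/2) *\<^sub>R (partial_x w z + bc_j * partial_y w z)"

text \<open>Intended for open \<open>S\<close>. Differentiability is real (Frechet) differentiability.\<close>

fun Ck_on :: "nat \<Rightarrow> complex set \<Rightarrow> (complex \<Rightarrow> 'a::real_normed_vector) \<Rightarrow> bool"
  where
    "Ck_on 0 S f \<longleftrightarrow> continuous_on S f"
  | "Ck_on (Suc k) S f \<longleftrightarrow>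
       f differentiable_on S \<and> Ck_on k S (partial_x f) \<and> Ck_on k S (partial_y f)"


section \<open>The Dirichlet problem\<close>

text \<open>Classical solutions: the \<open>C\<^sup>2\<close> condition makes both applications of \<open>dbar\<close> genuine
  derivatives, and continuity on the closed disk ties the boundary values to the interior.
  A solution is a function on the closed disk, hence the extensionality condition: without it,
  changing values outside the disk would give different solutions.\<close>

definition dirichlet_dbar2_solutions :: "(complex \<Rightarrow> bicomplex) set"
  where "dirichlet_dbar2_solutions =
    {w \<in> extensional (cball 0 1).
       Ck_on 2 (ball 0 1) w \<and>
       continuous_on (cball 0 1) w \<and>
       (\<forall>z\<in>ball 0 1. dbar (dbar w) z = 0) \<and>
       (\<forall>z\<in>sphere 0 1. w z = 0)}"

end

theory Submission imports Defs begin

text \<open>For any constant \<open>c\<close>, the function \<open>w = (1 - \<bar>z\<bar>\<^sup>2) c\<close> vanishes on the circle, and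
  \<open>dbar w = - (x + j y) c\<close>. Applying \<open>dbar\<close> once more gives \<open>- (1 + j\<^sup>2) c / 2 = 0\<close>.\<close>

text \<open>Openness of \<open>S\<close> puts a short horizontal segment through \<open>z\<close>
  inside \<open>S\<close>, and the derivative sees only that segment. Such congruences carry results
  about a function on the whole plane over to its restriction to the closed disk.\<close>

lemma partial_x_cong:
  assumes "open S" "z \<in> S" "\<And>u. u \<in> S \<Longrightarrow> f u = g u"
  shows "partial_x f z = partial_x g z"
proof -
  have "((\<lambda>t::real. z + of_real t) \<longlongrightarrow> z + of_real 0) (nhds 0)"
    by (intro tendsto_intros filterlim_ident)
  then have "\<forall>\<^sub>F t::real in nhds 0. z + of_real t \<in> S"
    using assms(1,2) by (intro topological_tendstoD) auto
  then have "\<forall>\<^sub>F t::real in nhds 0. t \<in> UNIV \<longrightarrow> f (z + of_real t) = g (z + of_real t)"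
    by eventually_elim (simp add: assms(3))
  then show ?thesis
    unfolding partial_x_def by (intro vector_derivative_cong_eq) auto
qed

lemma partial_y_cong:
  assumes "open S" "z \<in> S" "\<And>u. u \<in> S \<Longrightarrow> f u = g u"
  shows "partial_y f z = partial_y g z"
proof -
  have "((\<lambda>t::real. z + \<i> * of_real t) \<longlongrightarrow> z + \<i> * of_real 0) (nhds 0)"
    by (intro tendsto_intros filterlim_ident)
  then have "\<forall>\<^sub>F t::real in nhds 0. z + \<i> * of_real t \<in> S"
    using assms(1,2) by (intro topological_tendstoD) auto
  then have "\<forall>\<^sub>F t::real in nhds 0. t \<in> UNIV \<longrightarrow> f (z + \<i> * of_real t) = g (z + \<i> * of_real t)"
    by eventually_elim (simp add: assms(3))
  then show ?thesis
    unfolding partial_y_def by (intro vector_derivative_cong_eq) auto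
qed

lemma dbar_cong:
  assumes "open S" "z \<in> S" "\<And>u. u \<in> S \<Longrightarrow> f u = g u"
  shows "dbar f z = dbar g z"
  using partial_x_cong[OF assms] partial_y_cong[OF assms] by (simp add: dbar_def)

text \<open>Agreement on an open set passes to the partial derivatives, so the induction has to
  leave both functions arbitrary.\<close>

lemma Ck_on_cong:
  assumes "open S" "\<And>u. u \<in> S \<Longrightarrow> f u = g u" "Ck_on k S g"
  shows "Ck_on k S f"
  using assms(2,3)
proof (induction k arbitrary: f g)
  case 0
  then show ?case by (simp cong: continuous_on_cong)
next
  case (Suc k)
  have "f differentiable_on S"
    unfolding differentiable_on_def
  proof
    fix x assume x: "x \<in> S"
    then have "g differentiable at x within S"
      using Suc.prems(2) by (simp add: differentiable_on_def)
    then show "f differentiable at x within S"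
      \<comment> \<open>The functions agree on all of \<open>S\<close>, so any positive radius would
        serve here.\<close>
      by (rule differentiable_transform_within[OF _ zero_less_one x]) (simp add: Suc.prems(1))
  qed
  moreover have "Ck_on k S (partial_x f)"
    using Suc.IH[of "partial_x f", OF partial_x_cong[OF assms(1) _ Suc.prems(1)]] Suc.prems(2)
    by simp
  moreover have "Ck_on k S (partial_y f)"
    using Suc.IH[of "partial_y f", OF partial_y_cong[OF assms(1) _ Suc.prems(1)]] Suc.prems(2)
    by simp
  ultimately show ?case by simp
qed

text \<open>Chain rule along the horizontal line through \<open>z\<close>, with real linearity of
  \<open>D\<close> giving \<open>D (of_real t) = t *\<^sub>R D 1\<close>.\<close>

lemma partial_x_eq:
  assumes "(f has_derivative D) (at z)"
  shows "partial_x f z = D 1"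
proof -
  interpret bounded_linear D using assms by (rule has_derivative_bounded_linear)
  have "((\<lambda>t::real. z + of_real t) has_derivative of_real) (at 0)"
    by (auto intro!: derivative_eq_intros)
  then have "((\<lambda>t::real. f (z + of_real t)) has_derivative (\<lambda>t. D (of_real t))) (at 0)"
    using assms has_derivative_compose[of "\<lambda>t. z + of_real t" of_real 0 UNIV f D] by simp
  moreover have "(\<lambda>t::real. D (of_real t)) = (\<lambda>t. t *\<^sub>R D 1)"
    by (simp add: of_real_def scaleR)
  ultimately show ?thesis
    by (simp add: partial_x_def has_vector_derivative_def vector_derivative_at)
qed

lemma partial_y_eq:
  assumes "(f has_derivative D) (at z)"
  shows "partial_y f z = D \<i>"
proof -
  interpret bounded_linear D using assms by (rule has_derivative_bounded_linear)
  have "((\<lambda>t::real. z + \<i> * of_real t) has_derivative (\<lambda>t. \<i> * of_real t)) (at 0)"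
    by (auto intro!: derivative_eq_intros)
  then have "((\<lambda>t::real. f (z + \<i> * of_real t)) has_derivative (\<lambda>t. D (\<i> * of_real t))) (at 0)"
    using assms has_derivative_compose[of "\<lambda>t. z + \<i> * of_real t" _ 0 UNIV f D] by simp
  moreover have "(\<lambda>t::real. D (\<i> * of_real t)) = (\<lambda>t. t *\<^sub>R D \<i>)"
    by (simp add: of_real_def scaleR)
  ultimately show ?thesis
    by (simp add: partial_y_def has_vector_derivative_def vector_derivative_at)
qed

definition disk_bump :: "'a::real_normed_vector \<Rightarrow> complex \<Rightarrow> 'a"
  where "disk_bump c z = (1 - (Re z)\<^sup>2 - (Im z)\<^sup>2) *\<^sub>R c"

lemma has_derivative_disk_bump:
  "(disk_bump c has_derivative (\<lambda>h. (- 2 * (Re z * Re h + Im z * Im h)) *\<^sub>R c)) (at z)"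
  unfolding disk_bump_def[abs_def]
  by (auto intro!: derivative_eq_intros simp: algebra_simps)

lemma has_derivative_linear_combination:
  fixes a b :: "'a::real_normed_vector"
  shows "((\<lambda>z. Re z *\<^sub>R a + Im z *\<^sub>R b) has_derivative (\<lambda>h. Re h *\<^sub>R a + Im h *\<^sub>R b)) (at z)"
  by (auto intro!: derivative_eq_intros)

text \<open>The zero terms keep both results in the shape of
  \<open>has_derivative_linear_combination\<close>, which then handles every second
  derivative.\<close>

lemma partial_disk_bump:
  "partial_x (disk_bump c) = (\<lambda>z. Re z *\<^sub>R (- 2 *\<^sub>R c) + Im z *\<^sub>R 0)"
  "partial_y (disk_bump c) = (\<lambda>z. Re z *\<^sub>R 0 + Im z *\<^sub>R (- 2 *\<^sub>R c))"
  by (simp_all add: fun_eq_iff partial_x_eq[OF has_derivative_disk_bump]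
      partial_y_eq[OF has_derivative_disk_bump] mult.commute)

lemma differentiable_on_if_has_derivative:
  assumes "\<And>z. (f has_derivative D z) (at z)"
  shows "f differentiable_on S"
  using assms unfolding differentiable_on_def differentiable_def
  by (meson has_derivative_at_withinI)

text \<open>The partial derivatives are the constants \<open>a\<close> and \<open>b\<close>. Order
  one is what the partial derivatives of \<open>disk_bump c\<close> must satisfy.\<close>

lemma Ck_on_linear_combination:
  fixes a b :: "'a::real_normed_vector"
  shows "Ck_on (Suc 0) S (\<lambda>z. Re z *\<^sub>R a + Im z *\<^sub>R b)"
  by (simp add: partial_x_eq[OF has_derivative_linear_combination, abs_def]
      partial_y_eq[OF has_derivative_linear_combination, abs_def]
      differentiable_on_if_has_derivative[OF has_derivative_linear_combination])

lemma Ck_on_disk_bump: "Ck_on 2 S (disk_bump c)"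
  unfolding numeral_2_eq_2 Ck_on.simps(2)[of "Suc 0"] partial_disk_bump
  by (intro conjI Ck_on_linear_combination
      differentiable_on_if_has_derivative[OF has_derivative_disk_bump])

text \<open>The factor 1/2 in \<open>dbar\<close> cancels the 2 from differentiating the squares.
  The result is again a linear combination of \<open>Re z\<close> and \<open>Im z\<close>.\<close>

lemma dbar_disk_bump:
  "dbar (disk_bump c) = (\<lambda>z. Re z *\<^sub>R (- c) + Im z *\<^sub>R (- (bc_j * c)))"
  by (simp add: fun_eq_iff dbar_def partial_disk_bump scaleR_diff_right)

lemma dbar_dbar_disk_bump: "dbar (dbar (disk_bump c)) z = 0"
proof -
  have "bc_j * (bc_j * c) = - c"
    by (simp add: bc_j_squared flip: mult.assoc)
  then show ?thesis
    unfolding dbar_disk_bump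
    \<comment> \<open>Pulling out the signs would destroy the shape that
      \<open>has_derivative_linear_combination\<close> matches, hence the deleted rule.\<close>
    by (simp add: dbar_def partial_x_eq[OF has_derivative_linear_combination]
        partial_y_eq[OF has_derivative_linear_combination] del: scaleR_minus_right)
qed

lemma restrict_disk_bump_solution:
  "restrict (disk_bump c) (cball 0 1) \<in> dirichlet_dbar2_solutions" (is "?w \<in> _")
proof -
  have eq: "?w u = disk_bump c u" if "u \<in> ball 0 1" for u
    using that by simp
  have "continuous_on (cball 0 1) (disk_bump c)"
    unfolding disk_bump_def[abs_def] by (intro continuous_intros)
  then have "continuous_on (cball 0 1) ?w"
    by (rule continuous_on_eq) simp
  moreover have "Ck_on 2 (ball 0 1) ?w"
    by (rule Ck_on_cong[OF open_ball eq Ck_on_disk_bump])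
  moreover have "dbar (dbar ?w) z = 0" if "z \<in> ball 0 1" for z
  proof -
    \<comment> \<open>The outer \<open>dbar\<close> differentiates \<open>dbar ?w\<close>, so
      agreement is needed throughout the open disk and not only at \<open>z\<close>.\<close>
    have "dbar ?w u = dbar (disk_bump c) u" if "u \<in> ball 0 1" for u
      by (rule dbar_cong[OF open_ball that eq])
    then have "dbar (dbar ?w) z = dbar (dbar (disk_bump c)) z"
      by (rule dbar_cong[OF open_ball that])
    then show ?thesis
      by (simp only: dbar_dbar_disk_bump)
  qed
  moreover have "?w z = 0" if "z \<in> sphere 0 1" for z
  proof -
    have "(Re z)\<^sup>2 + (Im z)\<^sup>2 = 1"
      using that by (simp flip: cmod_power2)
    with that show ?thesis
      by (simp add: disk_bump_def)
  qed
  ultimately show ?thesis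
    by (simp add: dirichlet_dbar2_solutions_def)
qed

theorem proposition3p2: "infinite dirichlet_dbar2_solutions"
proof (rule infinite_super)
  \<comment> \<open>Real multiples of the unit already form an infinite family.\<close>
  let ?w = "\<lambda>t::real. restrict (disk_bump (of_real t :: bicomplex)) (cball 0 1)"
  show "range ?w \<subseteq> dirichlet_dbar2_solutions"
    using restrict_disk_bump_solution by blast
  have "inj ?w"
  proof (rule injI)
    fix s t assume "?w s = ?w t"
    \<comment> \<open>The factor \<open>1 - \<bar>z\<bar>\<^sup>2\<close> is 1 at the origin, so the
      value there recovers the parameter.\<close>
    then have "?w s 0 = ?w t 0" by (rule fun_cong)
    then show "s = t" by (simp add: disk_bump_def)
  qed
  then show "infinite (range ?w)"
    using infinite_UNIV_char_0 by (simp add: finite_image_iff)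
qed

end
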